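(* Let $M$ be an infinite image partition regular matrix with entries from $\mathbb{Q}$, and let $\mathcal{M}$ be a collection of $M$-subtracted image partition regular matrices. Then $\bigcap_{A\in\mathcal{M}}I(A)\neq\emptyset$.
   Context: $\omega=\{0,1,2,\dots\}$, $\mathbb{N}=\{1,2,\dots\}$. Matrices considered have each row with only finitely many nonzero entries, so $A\vec{x}$ is defined. For $u,v\in\mathbb{N}\cup\{\omega\}$, a $u\times v$ matrix $A$ with rational entries is image partition regular if whenever $r\in\mathbb{N}$ and $\mathbb{N}=\bigcup_{i=1}^r C_i$, there exist $i\in\{1,\dots,r\}$ and $\vec{x}\in\mathbb{N}^v$ with $A\vec{x}\in C_i^u$. Given an infinite image partition regular matrix $M$ with rational entries, an $\omega\times\omega$ matrix $A$ with entries from $\mathbb{Q}$ is $M$-subtracted image partition regular if (1) no row of $A$ is $\vec{0}$; (2) for each $i\in\omega$, $\{j\in\omega:a_{ij}\neq0\}$ is finite; (3) writing $\vec{c_0},\vec{c_1},\vec{c_2},\dots$ for the columns of $A$, there exist $n\in\omega$ and $k\in\mathbb{N}$ such that the rows of the matrix $(\vec{c_n}\ \vec{c_{n+1}}\ \cdots\ \vec{c_{n+k-1}})$ are precisely the rows of a finite image partition regular matrix, and the remaining columns of $A$ are precisely the columns of $M$. $\beta\mathbb{N}$ is the set of ultrafilters on $\mathbb{N}$. For a matrix $A$ (finite or infinite) with rational entries, $I(A)=\{p\in\beta\mathbb{N}:$ for every $P\in p$ there exists $\vec{x}$ with entries from $\mathbb{N}$ such that all entries of $A\vec{x}$ are in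 $P\}$. *)

theory Defs
  imports Complex_Main "HOL-Library.Extended_Nat" "HOL-Library.FuncSet"
begin

text \<open>
  A \<open>u \<times> v\<close> matrix is a function \<^typ>\<open>nat \<Rightarrow> nat \<Rightarrow> rat\<close> together with sizes \<open>u v :: enat\<close>,
  where \<open>\<infinity>\<close> plays the role of \<open>\<omega>\<close>; entries outside the index range are irrelevant.
  The set \<open>\<nat> = {1, 2, \<dots>}\<close> is \<open>{1..} :: nat set\<close>.
\<close>

type_synonym matrix = "nat \<Rightarrow> nat \<Rightarrow> rat"

definition row_finite :: "enat \<Rightarrow> enat \<Rightarrow> matrix \<Rightarrow> bool" where
  "row_finite u v A \<longleftrightarrow> (\<forall>i. enat i < u \<longrightarrow> finite {j. enat j < v \<and> A i j \<noteq> 0})"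

text \<open>The sum ranges over the nonzero entries only, so it is a finite sum whenever the matrix is
  row-finite.\<close>

definition mat_vec :: "enat \<Rightarrow> matrix \<Rightarrow> (nat \<Rightarrow> nat) \<Rightarrow> nat \<Rightarrow> rat" where
  "mat_vec v A x i = (\<Sum>j | enat j < v \<and> A i j \<noteq> 0. A i j * of_nat (x j))"

definition pos_vec :: "enat \<Rightarrow> (nat \<Rightarrow> nat) \<Rightarrow> bool" where
  "pos_vec v x \<longleftrightarrow> (\<forall>j. enat j < v \<longrightarrow> x j \<in> {1..})"

definition image_in :: "enat \<Rightarrow> enat \<Rightarrow> matrix \<Rightarrow> (nat \<Rightarrow> nat) \<Rightarrow> nat set \<Rightarrow> bool" where
  "image_in u v A x C \<longleftrightarrow> (\<forall>i. enat i < u \<longrightarrow> mat_vec v A x i \<in> of_nat ` C)"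

definition image_partition_regular :: "enat \<Rightarrow> enat \<Rightarrow> matrix \<Rightarrow> bool" where
  "image_partition_regular u v A \<longleftrightarrow>
     (\<forall>r\<ge>1. \<forall>C :: nat \<Rightarrow> nat set. {1..} = (\<Union>i\<in>{1..r}. C i) \<longrightarrow>
        (\<exists>i\<in>{1..r}. \<exists>x. pos_vec v x \<and> image_in u v A x (C i)))"

text \<open>
  In the last clause the rows of the block of columns \<open>n, \<dots>, n+k-1\<close> are compared with the rows
  of the finite matrix \<open>B\<close> as sets of vectors of length \<open>k\<close> (the block has infinitely many rows).
  The remaining columns are compared with those of \<open>M\<close> as indexed families, that is, with
  multiplicities but irrespective of order.
\<close>

definition subtracted_ipr :: "matrix \<Rightarrow> matrix \<Rightarrow> bool" where
  "subtracted_ipr M A \<longleftrightarrow>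
     (\<forall>i. \<exists>j. A i j \<noteq> 0) \<and>
     (\<forall>i. finite {j. A i j \<noteq> 0}) \<and>
     (\<exists>n k. k \<ge> 1 \<and>
        (\<exists>m\<ge>1. \<exists>B. image_partition_regular (enat m) (enat k) B \<and>
           range (\<lambda>i. restrict (\<lambda>j. A i (n + j)) {..<k}) =
             (\<lambda>i. restrict (B i) {..<k}) ` {..<m}) \<and>
        (\<exists>\<sigma>. bij_betw \<sigma> UNIV (- {n..<n + k}) \<and> (\<forall>i j. M i j = A i (\<sigma> j))))"

definition betaN :: "nat set set set" where
  "betaN = {p. p \<subseteq> Pow {1..} \<and> {1..} \<in> p \<and> {} \<notin> p \<and>
     (\<forall>P\<in>p. \<forall>Q\<in>p. P \<inter> Q \<in> p) \<and>
     (\<forall>P\<in>p. \<forall>Q. P \<subseteq> Q \<and> Q \<subseteq> {1..} \<longrightarrow> Q \<in> p) \<and>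
     (\<forall>P. P \<subseteq> {1..} \<longrightarrow> P \<in> p \<or> {1..} - P \<in> p)}"

definition I_set :: "enat \<Rightarrow> enat \<Rightarrow> matrix \<Rightarrow> nat set set set" where
  "I_set u v A = {p \<in> betaN. \<forall>P\<in>p. \<exists>x. pos_vec v x \<and> image_in u v A x P}"

end

theory Submission
  imports Defs
begin

text \<open>
  Extend addition and multiplication of \<open>\<nat>\<close> to \<open>\<beta>\<nat>\<close>. If \<open>B\<close> is finite, then \<open>I(B)\<close> is a
  two-sided ideal of \<open>(\<beta>\<nat>, \<cdot>)\<close>, so the sets \<open>I(B)\<close>, \<open>B\<close> finite and image partition regular, have
  the finite intersection property (the product of members lies in all of them) and by compactness
  have a common member \<open>q\<close>. Pick \<open>r \<in> I(M)\<close>. If \<open>P \<in> q + r\<close>, there is \<open>y\<close> such that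
  \<open>- a + P \<in> r\<close> for each of the finitely many entries \<open>a\<close> of \<open>By\<close>; the intersection of these sets is
  in \<open>r\<close> and hence contains all entries of some \<open>Mz\<close>. So \<open>P\<close> contains all sums of an
  entry of \<open>By\<close> and an entry of \<open>Mz\<close>. Thus \<open>q + r \<in> I(A)\<close> for every \<open>M\<close>-subtracted \<open>A\<close>.
\<close>

section \<open>Filter calculus in \<open>betaN\<close>\<close>

lemma betaN_subset: "p \<in> betaN \<Longrightarrow> P \<in> p \<Longrightarrow> P \<subseteq> {1..}"
  unfolding betaN_def by blast

lemma betaN_UNIV: "p \<in> betaN \<Longrightarrow> {1..} \<in> p"
  unfolding betaN_def by blast

lemma betaN_empty: "p \<in> betaN \<Longrightarrow> {} \<notin> p"
  unfolding betaN_def by blast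

lemma betaN_member:
  assumes "p \<in> betaN" "P \<in> p"
  obtains a where "a \<in> P" "a \<ge> 1"
proof -
  have "P \<noteq> {}" "P \<subseteq> {1..}" using assms betaN_empty betaN_subset by blast+
  then show thesis using that by fastforce
qed

lemma betaN_Int: "p \<in> betaN \<Longrightarrow> P \<in> p \<Longrightarrow> Q \<in> p \<Longrightarrow> P \<inter> Q \<in> p"
  unfolding betaN_def by blast

lemma betaN_mono: "p \<in> betaN \<Longrightarrow> P \<in> p \<Longrightarrow> P \<subseteq> Q \<Longrightarrow> Q \<subseteq> {1..} \<Longrightarrow> Q \<in> p"
  unfolding betaN_def by blast

lemma betaN_Int_iff:
  assumes "p \<in> betaN" "P \<subseteq> {1..}" "Q \<subseteq> {1..}"
  shows "P \<inter> Q \<in> p \<longleftrightarrow> P \<in> p \<and> Q \<in> p"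
  using assms betaN_Int betaN_mono by (meson inf_le1 inf_le2)

lemma betaN_Diff_iff:
  assumes "p \<in> betaN" "P \<subseteq> {1..}"
  shows "{1..} - P \<in> p \<longleftrightarrow> P \<notin> p"
proof
  assume "{1..} - P \<in> p"
  then show "P \<notin> p"
    using betaN_Int[OF assms(1), of P "{1..} - P"] betaN_empty[OF assms(1)] by auto
next
  assume "P \<notin> p"
  then show "{1..} - P \<in> p" using assms unfolding betaN_def by blast
qed

lemma betaN_INT:
  assumes "p \<in> betaN" "finite S" "S \<noteq> {}" "\<And>s. s \<in> S \<Longrightarrow> f s \<in> p"
  shows "(\<Inter>s\<in>S. f s) \<in> p"
  using assms(2-4)
proof (induction S rule: finite_ne_induct)
  case (insert s S)
  then show ?case using betaN_Int[OF assms(1), of "f s" "\<Inter>s\<in>S. f s"] by simp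
qed simp

lemma betaN_finite_cover:
  assumes p: "p \<in> betaN" and "finite S" "\<Union>S = {1..}"
  shows "\<exists>P\<in>S. P \<in> p"
proof (rule ccontr)
  assume a: "\<not> (\<exists>P\<in>S. P \<in> p)"
  have ne: "S \<noteq> {}" using assms(3) by auto
  have "(\<Inter>P\<in>S. {1..} - P) \<in> p"
  proof (rule betaN_INT[OF p assms(2) ne])
    fix P assume "P \<in> S"
    then show "{1..} - P \<in> p" using a assms(3) betaN_Diff_iff[OF p, of P] by blast
  qed
  moreover have "(\<Inter>P\<in>S. {1..} - P) = {}" using ne assms(3) by blast
  ultimately show False using betaN_empty[OF p] by simp
qed

section \<open>Existence of ultrafilters\<close>

text \<open>Zorn's lemma gives a maximal family with the finite intersection property above
  \<open>E\<close>, and maximality makes it an ultrafilter.\<close>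

lemma ultrafilter_extending:
  assumes sub: "E \<subseteq> Pow {1..}"
    and fip: "\<And>S. finite S \<Longrightarrow> S \<subseteq> E \<Longrightarrow> {1..} \<inter> \<Inter>S \<noteq> {}"
  shows "\<exists>p\<in>betaN. E \<subseteq> p"
proof -
  \<comment> \<open>The factor \<open>{1..}\<close> makes the empty family intersect in
    \<open>{1..}\<close> instead of all of \<open>nat\<close>, which contains 0.\<close>
  define Z where "Z = {D. E \<subseteq> D \<and> D \<subseteq> Pow {1::nat..} \<and>
    (\<forall>S. finite S \<longrightarrow> S \<subseteq> D \<longrightarrow> {1..} \<inter> \<Inter>S \<noteq> {})}"
  have "\<exists>p\<in>Z. \<forall>X\<in>Z. p \<subseteq> X \<longrightarrow> X = p"
  proof (rule subset_Zorn_nonempty)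
    show "Z \<noteq> {}" using sub fip unfolding Z_def by blast
  next
    fix \<C> assume ne: "\<C> \<noteq> {}" and ch: "subset.chain Z \<C>"
    have CZ: "\<C> \<subseteq> Z" using ch by (simp add: subset_chain_def)
    have "{1..} \<inter> \<Inter>S \<noteq> {}" if S: "finite S" "S \<subseteq> \<Union>\<C>" for S
    proof -
      obtain X where "X \<in> \<C>" "S \<subseteq> X"
        by (rule finite_subset_Union_chain[OF S ne ch])
      then show ?thesis using CZ S(1) unfolding Z_def by blast
    qed
    moreover have "E \<subseteq> \<Union>\<C>" "\<Union>\<C> \<subseteq> Pow {1..}" using CZ ne unfolding Z_def by blast+
    ultimately show "\<Union>\<C> \<in> Z" unfolding Z_def by blast
  qed
  then obtain p where p: "p \<in> Z" and max: "\<And>X. X \<in> Z \<Longrightarrow> p \<subseteq> X \<Longrightarrow> X = p" by blast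
  have fipp: "{1..} \<inter> \<Inter>S \<noteq> {}" if "finite S" "S \<subseteq> p" for S
    using p that unfolding Z_def by blast
  have psub: "p \<subseteq> Pow {1..}" and Ep: "E \<subseteq> p" using p unfolding Z_def by auto
  \<comment> \<open>Adjoining such an \<open>X\<close> to \<open>p\<close> stays inside
    \<open>Z\<close>, so by maximality \<open>X\<close> is already there. The closure properties of
    an ultrafilter all follow from this.\<close>
  have mem: "X \<in> p" if X: "X \<subseteq> {1..}" and
    meets: "\<And>S. finite S \<Longrightarrow> S \<subseteq> p \<Longrightarrow> X \<inter> \<Inter>S \<noteq> {}" for X
  proof -
    have "{1..} \<inter> \<Inter>S \<noteq> {}" if "finite S" "S \<subseteq> insert X p" for S
      using meets[of "S - {X}"] that X by blast
    then have "insert X p \<in> Z" using psub Ep X unfolding Z_def by blast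
    then show ?thesis using max by blast
  qed
  have "{1..} \<in> p" using fipp by (intro mem) auto
  moreover have "{} \<notin> p" using fipp[of "{{}}"] by auto
  moreover have "P \<inter> Q \<in> p" if "P \<in> p" "Q \<in> p" for P Q
  proof (rule mem)
    show "P \<inter> Q \<subseteq> {1..}" using that psub by blast
    show "P \<inter> Q \<inter> \<Inter>S \<noteq> {}" if S: "finite S" "S \<subseteq> p" for S
      using fipp[of "insert P (insert Q S)"] S \<open>P \<in> p\<close> \<open>Q \<in> p\<close> by simp blast
  qed
  moreover have "Q \<in> p" if "P \<in> p" "P \<subseteq> Q" "Q \<subseteq> {1..}" for P Q
  proof (rule mem)
    show "Q \<inter> \<Inter>S \<noteq> {}" if S: "finite S" "S \<subseteq> p" for S
      using fipp[of "insert P S"] S \<open>P \<in> p\<close> \<open>P \<subseteq> Q\<close> by simp blast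
  qed (use that in auto)
  moreover have "P \<in> p \<or> {1..} - P \<in> p" if P: "P \<subseteq> {1..}" for P
  proof (rule ccontr)
    assume "\<not> ?thesis"
    \<comment> \<open>If neither set can be adjoined, each misses a finite intersection from
      \<open>p\<close>; the two intersections together then leave no point of
      \<open>{1..}\<close>.\<close>
    then obtain S T where S: "finite S" "S \<subseteq> p" "P \<inter> \<Inter>S = {}"
      and T: "finite T" "T \<subseteq> p" "({1..} - P) \<inter> \<Inter>T = {}"
      using mem[OF P] mem[of "{1..} - P"] by blast
    have "{1..} \<inter> \<Inter>(S \<union> T) \<noteq> {}" using S T by (intro fipp) auto
    then show False using S(3) T(3) by blast
  qed
  ultimately have "p \<in> betaN" using psub unfolding betaN_def by blast
  then show ?thesis using Ep by blast
qed

text \<open>By De Morgan, the complements of members of \<open>B\<close> have the finite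
  intersection property exactly when no finite part of \<open>B\<close> covers. Compactness enters
  below in this form.\<close>

lemma ultrafilter_avoiding:
  assumes "B \<subseteq> Pow {1..}" "\<And>S. finite S \<Longrightarrow> S \<subseteq> B \<Longrightarrow> \<Union>S \<noteq> {1..}"
  shows "\<exists>p\<in>betaN. p \<inter> B = {}"
proof -
  have "\<exists>p\<in>betaN. (\<lambda>P. {1..} - P) ` B \<subseteq> p"
  proof (rule ultrafilter_extending)
    fix S assume S: "finite S" "S \<subseteq> (\<lambda>P. {1..} - P) ` B"
    then obtain T where T: "T \<subseteq> B" "finite T" "S = (\<lambda>P. {1..} - P) ` T"
      by (meson finite_subset_image)
    have "\<Union>T \<noteq> {1..}" "\<Union>T \<subseteq> {1..}" using T assms by auto
    then have "{1..} - \<Union>T \<noteq> {}" by blast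
    then show "{1..} \<inter> \<Inter>S \<noteq> {}" unfolding T(3) by blast
  qed auto
  then obtain p where p: "p \<in> betaN" "\<And>P. P \<in> B \<Longrightarrow> {1..} - P \<in> p" by blast
  have "P \<notin> p" if "P \<in> B" for P
    using p(2)[OF that] betaN_Diff_iff[OF p(1), of P] assms(1) that by blast
  then show ?thesis using p(1) by blast
qed

section \<open>Operations on ultrafilters\<close>

text \<open>For \<open>f = (+)\<close> and \<open>f = (*)\<close> this is the extension of the operation to \<open>\<beta>\<nat>\<close> that is
  continuous in its left argument.\<close>

definition ultra_op :: "(nat \<Rightarrow> nat \<Rightarrow> nat) \<Rightarrow> nat set set \<Rightarrow> nat set set \<Rightarrow> nat set set" where
  "ultra_op f p q =
     {P. P \<subseteq> {1..} \<and> {a \<in> {1..}. {b \<in> {1..}. f a b \<in> P} \<in> q} \<in> p}"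

text \<open>The map \<open>D\<close> below respects intersection, inclusion and complement, because
  preimages do and \<open>q\<close> is an ultrafilter. Hence pulling \<open>p\<close> back along
  \<open>D\<close> gives an ultrafilter again.\<close>

lemma ultra_op_betaN:
  assumes p: "p \<in> betaN" and q: "q \<in> betaN"
    and f: "\<And>a b. a \<ge> 1 \<Longrightarrow> b \<ge> 1 \<Longrightarrow> f a b \<ge> 1"
  shows "ultra_op f p q \<in> betaN"
proof -
  define s where "s a P = {b \<in> {1..}. f a b \<in> P}" for a P
  define D where "D P = {a \<in> {1..}. s a P \<in> q}" for P
  have op: "ultra_op f p q = {P. P \<subseteq> {1..} \<and> D P \<in> p}"
    unfolding ultra_op_def D_def s_def ..
  have s_sub: "s a P \<subseteq> {1..}" for a P by (auto simp: s_def)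
  have D_sub: "D P \<subseteq> {1..}" for P by (auto simp: D_def)
  have "D {1..} = {1..}"
  proof -
    have "s a {1..} = {1..}" if "a \<ge> 1" for a using f that by (auto simp: s_def)
    then show ?thesis using betaN_UNIV[OF q] by (auto simp: D_def)
  qed
  moreover have "D {} = {}" using betaN_empty[OF q] by (auto simp: D_def s_def)
  moreover have "D (P \<inter> Q) = D P \<inter> D Q" for P Q
  proof -
    have "s a (P \<inter> Q) = s a P \<inter> s a Q" for a by (auto simp: s_def)
    then show ?thesis using betaN_Int_iff[OF q s_sub s_sub] by (auto simp: D_def)
  qed
  moreover have "D P \<subseteq> D Q" if "P \<subseteq> Q" for P Q
  proof -
    have "s a P \<subseteq> s a Q" for a using that by (auto simp: s_def)
    then show ?thesis using betaN_mono[OF q _ _ s_sub] by (fastforce simp: D_def)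
  qed
  moreover have "D ({1..} - P) = {1..} - D P" for P
  proof -
    have "s a ({1..} - P) = {1..} - s a P" if "a \<ge> 1" for a
      using f[OF that] by (auto simp: s_def)
    then show ?thesis using betaN_Diff_iff[OF q s_sub] by (auto simp: D_def)
  qed
  ultimately have D: "D {1..} = {1..}" "D {} = {}" "\<And>P Q. D (P \<inter> Q) = D P \<inter> D Q"
    "\<And>P Q. P \<subseteq> Q \<Longrightarrow> D P \<subseteq> D Q" "\<And>P. D ({1..} - P) = {1..} - D P"
    by blast+
  have mem: "P \<in> ultra_op f p q \<longleftrightarrow> P \<subseteq> {1..} \<and> D P \<in> p" for P by (simp add: op)
  have "{1..} \<in> ultra_op f p q" using betaN_UNIV[OF p] by (simp only: mem D) simp
  moreover have "{} \<notin> ultra_op f p q" using betaN_empty[OF p] by (simp only: mem D) simp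
  moreover have "P \<inter> Q \<in> ultra_op f p q"
    if "P \<in> ultra_op f p q" "Q \<in> ultra_op f p q" for P Q
    using that betaN_Int[OF p] unfolding mem D by blast
  moreover have "Q \<in> ultra_op f p q"
    if "P \<in> ultra_op f p q" "P \<subseteq> Q" "Q \<subseteq> {1..}" for P Q
    using that betaN_mono[OF p _ D(4) D_sub] unfolding mem by blast
  moreover have "P \<in> ultra_op f p q \<or> {1..} - P \<in> ultra_op f p q" if "P \<subseteq> {1..}" for P
    using that betaN_Diff_iff[OF p D_sub] unfolding mem D by blast
  moreover have "ultra_op f p q \<subseteq> Pow {1..}" unfolding op by blast
  ultimately show ?thesis unfolding betaN_def by blast
qed

section \<open>Multiplicative ideals\<close>

lemma mat_vec_scale: "mat_vec v A (\<lambda>j. c * x j) i = of_nat c * mat_vec v A x i"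
  unfolding mat_vec_def sum_distrib_left by (rule sum.cong) auto

lemma I_setD:
  assumes "p \<in> I_set u v A" "P \<in> p"
  obtains x where "pos_vec v x" "image_in u v A x P"
  using assms unfolding I_set_def by blast

text \<open>One \<open>a\<close> whose section of \<open>P\<close> lies in \<open>q\<close>
  suffices: by linearity, scaling a vector for that section by \<open>a\<close> moves its image into
  \<open>P\<close>. The number of rows does not matter.\<close>

lemma I_set_mult_right:
  assumes p: "p \<in> betaN" and q: "q \<in> I_set u v A"
  shows "ultra_op (*) p q \<in> I_set u v A"
proof -
  have "\<exists>x. pos_vec v x \<and> image_in u v A x P" if P: "P \<in> ultra_op (*) p q" for P
  proof -
    have "{a \<in> {1..}. {b \<in> {1..}. a * b \<in> P} \<in> q} \<in> p"
      using P by (simp add: ultra_op_def)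
    with p obtain a where a: "a \<ge> 1" "{b \<in> {1..}. a * b \<in> P} \<in> q"
      by (rule betaN_member) blast
    obtain x where x: "pos_vec v x" "image_in u v A x {b \<in> {1..}. a * b \<in> P}"
      using q a(2) by (rule I_setD)
    have "pos_vec v (\<lambda>j. a * x j)" using x(1) a(1) by (auto simp: pos_vec_def)
    moreover have "image_in u v A (\<lambda>j. a * x j) P"
      using x(2) unfolding image_in_def mat_vec_scale by (force simp flip: of_nat_mult)
    ultimately show ?thesis by blast
  qed
  moreover have "ultra_op (*) p q \<in> betaN"
    using p q by (intro ultra_op_betaN) (auto simp: I_set_def)
  ultimately show ?thesis by (simp add: I_set_def)
qed

text \<open>Finitely many entries \<open>c i\<close> of an image can be handled at once: their sections of \<open>P\<close>
  intersect in a member of \<open>q\<close>.\<close>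

lemma I_set_finite_ultra_op:
  assumes p: "p \<in> I_set (enat m) v A" and q: "q \<in> betaN" and P: "P \<in> ultra_op f p q"
  obtains x c Q where "pos_vec v x" "\<And>i. i < m \<Longrightarrow> mat_vec v A x i = of_nat (c i)"
    "Q \<in> q" "\<And>i b. i < m \<Longrightarrow> b \<in> Q \<Longrightarrow> f (c i) b \<in> P"
proof -
  have "{a \<in> {1..}. {b \<in> {1..}. f a b \<in> P} \<in> q} \<in> p" using P by (simp add: ultra_op_def)
  with p obtain x where x: "pos_vec v x"
    "image_in (enat m) v A x {a \<in> {1..}. {b \<in> {1..}. f a b \<in> P} \<in> q}"
    by (rule I_setD)
  then have "\<forall>i. \<exists>a. i < m \<longrightarrow> mat_vec v A x i = of_nat a \<and> {b \<in> {1..}. f a b \<in> P} \<in> q"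
    unfolding image_in_def by auto
  then obtain c where c: "\<And>i. i < m \<Longrightarrow> mat_vec v A x i = of_nat (c i)"
    "\<And>i. i < m \<Longrightarrow> {b \<in> {1..}. f (c i) b \<in> P} \<in> q"
    by metis
  \<comment> \<open>For \<open>m = 0\<close> the intersection would be all of \<open>nat\<close>,
    which contains 0 and so is not in \<open>q\<close>.\<close>
  define Q where "Q = (if m = 0 then {1..} else \<Inter>i\<in>{..<m}. {b \<in> {1..}. f (c i) b \<in> P})"
  have "Q \<in> q"
    using betaN_UNIV[OF q] betaN_INT[OF q, of "{..<m}" "\<lambda>i. {b \<in> {1..}. f (c i) b \<in> P}"] c(2)
    by (auto simp: Q_def lessThan_empty_iff)
  moreover have "f (c i) b \<in> P" if "i < m" "b \<in> Q" for i b
    using that by (auto simp: Q_def split: if_splits)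
  ultimately show thesis using that x(1) c(1) by blast
qed

text \<open>Here the image entries \<open>c i\<close> come first, and a single \<open>b\<close> has
  to send all of them into \<open>P\<close>. Finiteness of the set of rows provides it.\<close>

lemma I_set_mult_left:
  assumes p: "p \<in> I_set (enat m) v A" and q: "q \<in> betaN"
  shows "ultra_op (*) p q \<in> I_set (enat m) v A"
proof -
  have "\<exists>x. pos_vec v x \<and> image_in (enat m) v A x P" if P: "P \<in> ultra_op (*) p q" for P
  proof -
    obtain x c Q where x: "pos_vec v x" "\<And>i. i < m \<Longrightarrow> mat_vec v A x i = of_nat (c i)"
      and Q: "Q \<in> q" "\<And>i b. i < m \<Longrightarrow> b \<in> Q \<Longrightarrow> c i * b \<in> P"
      using I_set_finite_ultra_op[OF p q P] by metis
    obtain b where b: "b \<in> Q" "b \<ge> 1" using q Q(1) by (rule betaN_member)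
    have "pos_vec v (\<lambda>j. b * x j)" using x(1) b(2) by (auto simp: pos_vec_def)
    moreover have "mat_vec v A (\<lambda>j. b * x j) i = of_nat (c i * b)" if "i < m" for i
      using x(2)[OF that] by (simp add: mat_vec_scale mult.commute)
    then have "image_in (enat m) v A (\<lambda>j. b * x j) P"
      using Q(2)[OF _ b(1)] by (auto simp: image_in_def simp del: of_nat_mult)
    ultimately show ?thesis by blast
  qed
  moreover have "ultra_op (*) p q \<in> betaN"
    using p q by (intro ultra_op_betaN) (auto simp: I_set_def)
  ultimately show ?thesis by (simp add: I_set_def)
qed

section \<open>A common member for all finite matrices\<close>

text \<open>A finite cover of \<open>{1..}\<close> by sets containing no image would be a colouring
  that contradicts partition regularity, so some ultrafilter avoids all such sets.\<close>

lemma image_partition_regular_I_set_nonempty: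
  assumes "image_partition_regular u v A"
  shows "\<exists>p. p \<in> I_set u v A"
proof -
  define B where "B = {P. P \<subseteq> {1..} \<and> \<not> (\<exists>x. pos_vec v x \<and> image_in u v A x P)}"
  have "\<exists>p\<in>betaN. p \<inter> B = {}"
  proof (rule ultrafilter_avoiding)
    fix S assume S: "finite S" "S \<subseteq> B"
    show "\<Union>S \<noteq> {1..}"
    proof
      assume cov: "\<Union>S = {1..}"
      then have "S \<noteq> {}" by auto
      then have "card S \<ge> 1" using S(1) by (simp add: Suc_leI card_gt_0_iff)
      obtain C where C: "bij_betw C {1..card S} S"
        using ex_bij_betw_nat_finite_1[OF S(1)] by blast
      then have "{1..} = (\<Union>i\<in>{1..card S}. C i)" using cov by (simp add: bij_betw_def)
      then obtain i where "i \<in> {1..card S}" "\<exists>x. pos_vec v x \<and> image_in u v A x (C i)"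
        using assms \<open>card S \<ge> 1\<close> unfolding image_partition_regular_def by blast
      then show False using C S(2) unfolding B_def bij_betw_def by blast
    qed
  qed (auto simp: B_def)
  then obtain p where "p \<in> betaN" "p \<inter> B = {}" by blast
  then have "p \<in> I_set u v A" using betaN_subset unfolding I_set_def B_def by blast
  then show ?thesis ..
qed

lemma finite_matrices_finite_I_set_Int:
  assumes "finite T" "\<And>m v A. (m, v, A) \<in> T \<Longrightarrow> image_partition_regular (enat m) v A"
  shows "\<exists>p\<in>betaN. \<forall>(m, v, A)\<in>T. p \<in> I_set (enat m) v A"
  using assms
proof (induction T rule: finite_induct)
  case empty
  show ?case using ultrafilter_extending[of "{}"] by auto
next
  case (insert t T)
  obtain p where p: "p \<in> betaN" "\<forall>(m, v, A)\<in>T. p \<in> I_set (enat m) v A"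
    using insert.IH insert.prems by blast
  obtain m v A where t: "t = (m, v, A)" by (cases t)
  obtain q where q: "q \<in> I_set (enat m) v A"
    using image_partition_regular_I_set_nonempty[OF insert.prems[of m v A]] t by auto
  then have qb: "q \<in> betaN" by (simp add: I_set_def)
  \<comment> \<open>In the product, \<open>p\<close> keeps the memberships for \<open>T\<close> and
    \<open>q\<close> supplies the one for the new matrix.\<close>
  have "ultra_op (*) p q \<in> betaN" using p(1) qb by (intro ultra_op_betaN) auto
  then show ?case using p(2) I_set_mult_left[OF _ qb] I_set_mult_right[OF p(1) q]
    by (intro bexI[of _ "ultra_op (*) p q"]) (auto simp: t)
qed

text \<open>Compactness: a finite cover by bad sets involves only one witnessing matrix per set. A
  common ultrafilter for these finitely many matrices contains a set of the cover, which is then not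
  bad.\<close>

lemma finite_matrices_I_set_Int:
  "\<exists>p\<in>betaN. \<forall>m v A. image_partition_regular (enat m) v A \<longrightarrow> p \<in> I_set (enat m) v A"
proof -
  define bad where "bad P = (\<lambda>(m, v, A). image_partition_regular (enat m) v A \<and>
    \<not> (\<exists>x. pos_vec v x \<and> image_in (enat m) v A x P))" for P
  have "\<exists>p\<in>betaN. p \<inter> {P. P \<subseteq> {1..} \<and> (\<exists>t. bad P t)} = {}"
  proof (rule ultrafilter_avoiding)
    fix S assume S: "finite S" "S \<subseteq> {P. P \<subseteq> {1..} \<and> (\<exists>t. bad P t)}"
    then have "\<forall>P\<in>S. \<exists>t. bad P t" by blast
    then obtain t where t: "\<And>P. P \<in> S \<Longrightarrow> bad P (t P)" by metis
    have "image_partition_regular (enat m) v A" if "(m, v, A) \<in> t ` S" for m v A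
    proof -
      obtain P where "P \<in> S" "t P = (m, v, A)" using \<open>(m, v, A) \<in> t ` S\<close> by (metis imageE)
      then show ?thesis using t[of P] by (simp add: bad_def)
    qed
    then obtain p where p: "p \<in> betaN" "\<forall>(m, v, A)\<in>t ` S. p \<in> I_set (enat m) v A"
      using finite_matrices_finite_I_set_Int[of "t ` S"] S(1) by blast
    have "P \<notin> p" if "P \<in> S" for P
    proof
      assume "P \<in> p"
      obtain m v A where tP: "t P = (m, v, A)" by (cases "t P")
      then have "p \<in> I_set (enat m) v A" using p(2) that by force
      then show False using t[OF that] \<open>P \<in> p\<close> by (auto simp: bad_def tP I_set_def)
    qed
    then show "\<Union>S \<noteq> {1..}" using betaN_finite_cover[OF p(1) S(1)] by blast
  qed auto
  then obtain p where p: "p \<in> betaN" "p \<inter> {P. P \<subseteq> {1..} \<and> (\<exists>t. bad P t)} = {}" by blast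
  then have "\<not> bad P t" if "P \<in> p" for P t using that betaN_subset by blast
  then show ?thesis using p(1) unfolding I_set_def bad_def by blast
qed

section \<open>Subtracted matrices\<close>

text \<open>The support of row \<open>i\<close> splits disjointly into its part in the block, a
  shift by \<open>n\<close> of the support of row \<open>i'\<close> of \<open>B\<close>, and the
  image under \<open>\<sigma>\<close> of the support of row \<open>i\<close> of
  \<open>M\<close>.\<close>

lemma mat_vec_column_split:
  assumes fin: "finite {j. A i j \<noteq> 0}"
    and \<sigma>: "bij_betw \<sigma> UNIV (- {n..<n + k})" and M: "\<And>j. M i j = A i (\<sigma> j)"
    and B: "\<And>j. j < k \<Longrightarrow> B i' j = A i (n + j)"
    and xy: "\<And>j. j < k \<Longrightarrow> x (n + j) = y j" and xz: "\<And>j. x (\<sigma> j) = z j"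
  shows "mat_vec \<infinity> A x i = mat_vec (enat k) B y i' + mat_vec \<infinity> M z i"
proof -
  let ?g = "\<lambda>j. A i j * of_nat (x j)"
  have inj: "inj \<sigma>" and rng: "range \<sigma> = - {n..<n + k}" using \<sigma> by (auto simp: bij_betw_def)
  have 1: "{j. A i j \<noteq> 0} = (+) n ` {j. j < k \<and> B i' j \<noteq> 0} \<union> \<sigma> ` {j. M i j \<noteq> 0}"
    (is "_ = ?U \<union> ?V")
  proof -
    have "j \<in> ?U \<union> ?V" if "A i j \<noteq> 0" for j
    proof (cases "j \<in> {n..<n + k}")
      case True
      then have "j = n + (j - n)" "j - n < k" by auto
      then show ?thesis using B[of "j - n"] that by fastforce
    next
      case False
      then obtain l where "j = \<sigma> l" using rng by blast
      then show ?thesis using M that by auto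
    qed
    then show ?thesis using B M by auto
  qed
  have 2: "?U \<inter> ?V = {}"
  proof -
    have "?V \<subseteq> - {n..<n + k}" using rng by blast
    moreover have "?U \<subseteq> {n..<n + k}" by auto
    ultimately show ?thesis by blast
  qed
  have "mat_vec \<infinity> A x i = sum ?g ?U + sum ?g ?V"
  proof -
    have "finite ?U" "finite ?V" using fin unfolding 1 by simp_all
    moreover have "mat_vec \<infinity> A x i = sum ?g (?U \<union> ?V)"
      unfolding 1[symmetric] by (simp add: mat_vec_def)
    ultimately show ?thesis using sum.union_disjoint[OF _ _ 2] by simp
  qed
  moreover have "sum ?g ?U = mat_vec (enat k) B y i'"
    unfolding mat_vec_def by (subst sum.reindex) (auto simp: B xy intro!: sum.cong)
  moreover have "sum ?g ?V = mat_vec \<infinity> M z i"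
    unfolding mat_vec_def using inj
    by (subst sum.reindex) (auto simp: M xz intro!: sum.cong inj_on_subset[OF inj])
  ultimately show ?thesis by simp
qed

text \<open>The block \<open>B\<close> varies with \<open>A\<close>, so \<open>q\<close> must serve
  every finite matrix. As neither \<open>q\<close> nor \<open>r\<close> depends on \<open>A\<close>,
  one sum works for the whole collection.\<close>

lemma subtracted_ipr_I_set:
  assumes A: "subtracted_ipr M A"
    and q: "\<And>m v B. image_partition_regular (enat m) v B \<Longrightarrow> q \<in> I_set (enat m) v B"
    and r: "r \<in> I_set \<infinity> \<infinity> M"
  shows "ultra_op (+) q r \<in> I_set \<infinity> \<infinity> A"
proof -
  obtain n k m B \<sigma> where fin: "\<And>i. finite {j. A i j \<noteq> 0}"
    and B: "image_partition_regular (enat m) (enat k) B"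
    and rows: "range (\<lambda>i. restrict (\<lambda>j. A i (n + j)) {..<k}) =
             (\<lambda>i. restrict (B i) {..<k}) ` {..<m}"
    and \<sigma>: "bij_betw \<sigma> UNIV (- {n..<n + k})" and M: "\<And>i j. M i j = A i (\<sigma> j)"
    using A unfolding subtracted_ipr_def by blast
  have qB: "q \<in> I_set (enat m) (enat k) B" and rb: "r \<in> betaN"
    using q[OF B] r by (auto simp: I_set_def)
  have "\<exists>x. pos_vec \<infinity> x \<and> image_in \<infinity> \<infinity> A x P" if P: "P \<in> ultra_op (+) q r" for P
  proof -
    obtain y c Q where y: "pos_vec (enat k) y"
        "\<And>i. i < m \<Longrightarrow> mat_vec (enat k) B y i = of_nat (c i)"
      and Q: "Q \<in> r" "\<And>i b. i < m \<Longrightarrow> b \<in> Q \<Longrightarrow> c i + b \<in> P"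
      using I_set_finite_ultra_op[OF qB rb P] by metis
    obtain z where z: "pos_vec \<infinity> z" "image_in \<infinity> \<infinity> M z Q" using r Q(1) by (rule I_setD)
    \<comment> \<open>The vector \<open>y\<close> is placed on the block, and \<open>z\<close> is
      carried to the remaining columns along \<open>\<sigma>\<close>.\<close>
    define x where "x j = (if j \<in> {n..<n + k} then y (j - n) else z (inv \<sigma> j))" for j
    have xz: "x (\<sigma> j) = z j" for j
    proof -
      have "\<sigma> j \<notin> {n..<n + k}" "inv \<sigma> (\<sigma> j) = j" using \<sigma> by (auto simp: bij_betw_def)
      then show ?thesis unfolding x_def by (simp only: if_False)
    qed
    have xy: "x (n + j) = y j" if "j < k" for j using that by (simp add: x_def)
    have "pos_vec \<infinity> x" using y(1) z(1) by (auto simp: pos_vec_def x_def)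
    moreover have "mat_vec \<infinity> A x i \<in> of_nat ` P" for i
    proof -
      \<comment> \<open>Infinitely many rows of \<open>A\<close> share the finitely many rows of
        \<open>B\<close>; \<open>i'\<close> is one that agrees with row \<open>i\<close> on the
        block.\<close>
      obtain i' where i': "i' < m"
        "restrict (\<lambda>j. A i (n + j)) {..<k} = restrict (B i') {..<k}"
        using rows by blast
      have "B i' j = A i (n + j)" if "j < k" for j
        using fun_cong[OF i'(2), of j] that by simp
      then have "mat_vec \<infinity> A x i = mat_vec (enat k) B y i' + mat_vec \<infinity> M z i"
        by (intro mat_vec_column_split[OF fin \<sigma> M _ xy xz])
      moreover obtain b where "b \<in> Q" "mat_vec \<infinity> M z i = of_nat b"
        using z(2) by (auto simp: image_in_def)
      ultimately show ?thesis using y(2) Q(2) i'(1) by (simp flip: of_nat_add)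
    qed
    then have "image_in \<infinity> \<infinity> A x P" by (simp add: image_in_def)
    ultimately show ?thesis by blast
  qed
  moreover have "ultra_op (+) q r \<in> betaN"
    using qB rb by (intro ultra_op_betaN) (auto simp: I_set_def)
  ultimately show ?thesis by (simp add: I_set_def)
qed

theorem theorem3p3:
  fixes M :: matrix and \<M> :: "matrix set"
  assumes "row_finite \<infinity> \<infinity> M"
    and "image_partition_regular \<infinity> \<infinity> M"
    and "\<And>A. A \<in> \<M> \<Longrightarrow> subtracted_ipr M A"
  shows "betaN \<inter> (\<Inter>A\<in>\<M>. I_set \<infinity> \<infinity> A) \<noteq> {}"
proof -
  obtain q where q: "q \<in> betaN"
    "\<And>m v B. image_partition_regular (enat m) v B \<Longrightarrow> q \<in> I_set (enat m) v B"
    using finite_matrices_I_set_Int by blast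
  obtain r where r: "r \<in> I_set \<infinity> \<infinity> M"
    using image_partition_regular_I_set_nonempty[OF assms(2)] by blast
  have "ultra_op (+) q r \<in> betaN"
    using q(1) r by (intro ultra_op_betaN) (auto simp: I_set_def)
  moreover have "ultra_op (+) q r \<in> I_set \<infinity> \<infinity> A" if "A \<in> \<M>" for A
    using subtracted_ipr_I_set[OF assms(3)[OF that] q(2) r] .
  ultimately show ?thesis by blast
qed

end
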